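(* Let $G=(V,E)$ be a directed graph on $n=|V|$ vertices with a positive real capacity $w(e)$ on each edge $e\in E$, a designated source vertex $s$ and a designated sink vertex $t\neq s$. Then there exists a set $\mathcal{C}_{min}$ containing at most $n-1$ $(s,t)$-cuts such that, for every vital edge $e$ of $G$, at least one mincut for $e$ belongs to $\mathcal{C}_{min}$.
   Context: An $(s,t)$-cut is a set $C\subset V$ with $s\in C$ and $t\notin C$; write $\overline{C}=V\setminus C$. An edge $(x,y)$ is a contributing edge of $C$ if $x\in C$ and $y\in\overline{C}$. The capacity $c(C)$ is the sum of $w(e)$ over the contributing edges $e$ of $C$. An $(s,t)$-mincut is an $(s,t)$-cut of minimum capacity; its capacity is denoted $f^*$. An edge $e$ is vital if removing $e$ from $G$ strictly decreases the capacity of the $(s,t)$-mincut. For an edge $e$, an $(s,t)$-cut $C$ is a mincut for $e$ if $e$ is a contributing edge of $C$ and $c(C)\le c(C')$ for every $(s,t)$-cut $C'$ of which $e$ is a contributing edge. *)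

theory Defs
  imports Complex_Main "Graph_Theory.Pair_Digraph"
begin

definition st_cut :: "'a pair_pre_digraph \<Rightarrow> 'a \<Rightarrow> 'a \<Rightarrow> 'a set \<Rightarrow> bool" where
  "st_cut G s t C \<longleftrightarrow> C \<subseteq> pverts G \<and> s \<in> C \<and> t \<notin> C"

definition contributing_edges :: "'a pair_pre_digraph \<Rightarrow> 'a set \<Rightarrow> ('a \<times> 'a) set" where
  "contributing_edges G C = {(x, y) \<in> parcs G. x \<in> C \<and> y \<in> pverts G - C}"

definition cut_capacity :: "'a pair_pre_digraph \<Rightarrow> ('a \<times> 'a \<Rightarrow> real) \<Rightarrow> 'a set \<Rightarrow> real" where
  "cut_capacity G w C = (\<Sum>e \<in> contributing_edges G C. w e)"

text \<open>The capacity of an \<open>(s,t)\<close>-mincut. In a finite digraph with distinct vertices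
  \<open>s\<close> and \<open>t\<close> the set of \<open>(s,t)\<close>-cuts is finite and nonempty, so the minimum is attained.\<close>
definition st_mincut_capacity :: "'a pair_pre_digraph \<Rightarrow> ('a \<times> 'a \<Rightarrow> real) \<Rightarrow> 'a \<Rightarrow> 'a \<Rightarrow> real" where
  "st_mincut_capacity G w s t = Min (cut_capacity G w ` {C. st_cut G s t C})"

definition remove_edge :: "'a pair_pre_digraph \<Rightarrow> 'a \<times> 'a \<Rightarrow> 'a pair_pre_digraph" where
  "remove_edge G e = G\<lparr>parcs := parcs G - {e}\<rparr>"

definition vital_edge :: "'a pair_pre_digraph \<Rightarrow> ('a \<times> 'a \<Rightarrow> real) \<Rightarrow> 'a \<Rightarrow> 'a \<Rightarrow> 'a \<times> 'a \<Rightarrow> bool" where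
  "vital_edge G w s t e \<longleftrightarrow>
     e \<in> parcs G \<and> st_mincut_capacity (remove_edge G e) w s t < st_mincut_capacity G w s t"

definition mincut_for_edge ::
    "'a pair_pre_digraph \<Rightarrow> ('a \<times> 'a \<Rightarrow> real) \<Rightarrow> 'a \<Rightarrow> 'a \<Rightarrow> 'a \<times> 'a \<Rightarrow> 'a set \<Rightarrow> bool" where
  "mincut_for_edge G w s t e C \<longleftrightarrow>
     st_cut G s t C \<and> e \<in> contributing_edges G C \<and>
     (\<forall>C'. st_cut G s t C' \<and> e \<in> contributing_edges G C' \<longrightarrow> cut_capacity G w C \<le> cut_capacity G w C')"

end

theory Submission
  imports Defs
begin

text \<open>
  If \<open>C\<close> and \<open>D\<close> are mincuts for vital edges \<open>e\<close> and \<open>e'\<close>, then \<open>e'\<close> cannot enter \<open>C\<close>: otherwise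
  submodularity, with the surplus contributed by the edges joining \<open>C - D\<close> and \<open>D - C\<close>, produces
  an \<open>(s,t)\<close>-cut of capacity below \<open>f\<^sup>*\<close>. So a mincut for a vital edge separates the endpoints of
  another vital edge only in the forward direction, and directions may be ignored. Treat the vital
  edges in increasing order of the capacity of their mincuts, selecting the mincut of an edge only
  if the edge contributes to no cut selected so far. An edge that does contribute to a
  selected cut has that cut as a mincut, because of the order; an edge that does not has
  its endpoints in one class of the partition induced by the selected cuts, which the new cut
  splits. A partition of the \<open>n\<close> vertices is refined at most \<open>n - 1\<close> times.
\<close>

text \<open>The distinct traces \<open>{C \<in> \<C>. v \<in> C}\<close> correspond to the classes
  of the partition of \<open>V\<close> induced by \<open>\<C>\<close>. Intersecting with
  \<open>\<C>\<close> maps the traces for \<open>insert D \<C>\<close> onto those for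
  \<open>\<C>\<close> and merges those of \<open>x\<close> and \<open>y\<close>, which
  \<open>D\<close> separates.\<close>

lemma card_traces_insert:
  assumes "finite V" and "x \<in> V" and "y \<in> V"
    and "\<And>C. C \<in> \<C> \<Longrightarrow> x \<in> C \<longleftrightarrow> y \<in> C"
    and "x \<in> D" and "y \<notin> D"
  shows "card ((\<lambda>v. {C \<in> \<C>. v \<in> C}) ` V) < card ((\<lambda>v. {C \<in> insert D \<C>. v \<in> C}) ` V)"
proof -
  let ?tr = "\<lambda>v. {C \<in> \<C>. v \<in> C}" and ?tr' = "\<lambda>v. {C \<in> insert D \<C>. v \<in> C}"
  have fin: "finite (?tr' ` V)" using assms(1) by simp
  have img: "?tr ` V = (\<lambda>A. A \<inter> \<C>) ` (?tr' ` V)"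
    unfolding image_image by (intro image_cong) auto
  have "?tr' x \<inter> \<C> = ?tr' y \<inter> \<C>" using assms(4) by blast
  moreover have "?tr' x \<noteq> ?tr' y" using assms(5,6) by blast
  ultimately have "\<not> inj_on (\<lambda>A. A \<inter> \<C>) (?tr' ` V)"
    using assms(2,3) unfolding inj_on_def by blast
  then show ?thesis
    unfolding img using fin card_image_le[OF fin, of "\<lambda>A. A \<inter> \<C>"] eq_card_imp_inj_on[OF fin]
    by (metis (no_types, lifting) le_neq_implies_less)
qed

locale st_network = pair_fin_digraph G for G :: "'a pair_pre_digraph" +
  fixes w :: "'a \<times> 'a \<Rightarrow> real" and s t :: 'a
  assumes w_pos: "e \<in> parcs G \<Longrightarrow> 0 < w e"
    and s_in_verts: "s \<in> pverts G" and t_in_verts: "t \<in> pverts G" and t_neq_s: "t \<noteq> s"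
begin

abbreviation c :: "'a set \<Rightarrow> real" where "c \<equiv> cut_capacity G w"

abbreviation fstar :: real where "fstar \<equiv> st_mincut_capacity G w s t"

lemma finite_st_cuts: "finite {C. st_cut G s t C}"
  by (rule finite_subset[of _ "Pow (pverts G)"]) (auto simp: st_cut_def)

lemma st_cut_source: "st_cut G s t {s}"
  using s_in_verts t_neq_s by (simp add: st_cut_def)

lemma st_cut_Int: "st_cut G s t C \<Longrightarrow> st_cut G s t D \<Longrightarrow> st_cut G s t (C \<inter> D)"
  and st_cut_Un: "st_cut G s t C \<Longrightarrow> st_cut G s t D \<Longrightarrow> st_cut G s t (C \<union> D)"
  by (auto simp: st_cut_def)

lemma mincut_capacity_le: "st_cut G s t C \<Longrightarrow> fstar \<le> c C"
  unfolding st_mincut_capacity_def using finite_st_cuts by (intro Min_le) auto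

lemma mem_contributing_edges:
  "e \<in> contributing_edges G C \<longleftrightarrow> e \<in> parcs G \<and> fst e \<in> C \<and> snd e \<notin> C"
  unfolding contributing_edges_def using in_arcsD2 by (cases e) auto

lemma cut_capacity_eq: "c C = (\<Sum>e\<in>parcs G. if fst e \<in> C \<and> snd e \<notin> C then w e else 0)"
proof -
  have "contributing_edges G C = {e \<in> parcs G. fst e \<in> C \<and> snd e \<notin> C}"
    using mem_contributing_edges by blast
  then show ?thesis
    unfolding cut_capacity_def by (simp add: sum.inter_filter)
qed

text \<open>An edge joining \<open>C - D\<close> and \<open>D - C\<close>, in either direction,
  contributes to exactly one of \<open>C\<close> and \<open>D\<close> but to neither their
  intersection nor their union, so its whole weight is surplus.\<close>

lemma cut_capacity_submodular:
  assumes "S \<subseteq> parcs G"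
    and "\<And>e. e \<in> S \<Longrightarrow> fst e \<in> C - D \<and> snd e \<in> D - C \<or> fst e \<in> D - C \<and> snd e \<in> C - D"
  shows "c (C \<inter> D) + c (C \<union> D) + sum w S \<le> c C + c D"
proof -
  have "sum w S = (\<Sum>e\<in>parcs G. if e \<in> S then w e else 0)"
    using assms(1) by (simp add: sum.inter_restrict[symmetric] Int_absorb1)
  moreover have "(if fst e \<in> C \<inter> D \<and> snd e \<notin> C \<inter> D then w e else 0)
      + (if fst e \<in> C \<union> D \<and> snd e \<notin> C \<union> D then w e else 0) + (if e \<in> S then w e else 0)
      \<le> (if fst e \<in> C \<and> snd e \<notin> C then w e else 0) + (if fst e \<in> D \<and> snd e \<notin> D then w e else 0)"
    if "e \<in> parcs G" for e
    using w_pos[OF that] assms(2)[of e] by auto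
  ultimately show ?thesis
    unfolding cut_capacity_eq by (simp only: sum.distrib[symmetric] sum_mono)
qed

lemma cut_capacity_remove_edge:
  assumes "e \<in> contributing_edges G C"
  shows "cut_capacity (remove_edge G e) w C = c C - w e"
proof -
  have "contributing_edges (remove_edge G e) C = contributing_edges G C - {e}"
    by (auto simp: contributing_edges_def remove_edge_def)
  moreover have "finite (contributing_edges G C)"
    by (rule finite_subset[OF _ pair_finite_arcs]) (auto simp: contributing_edges_def)
  ultimately show ?thesis
    using assms by (simp add: cut_capacity_def sum_diff1)
qed

lemma cut_capacity_remove_edge_other:
  assumes "e \<notin> contributing_edges G C"
  shows "cut_capacity (remove_edge G e) w C = c C"
proof -
  have "contributing_edges (remove_edge G e) C = contributing_edges G C"
    using assms by (auto simp: contributing_edges_def remove_edge_def)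
  then show ?thesis by (simp add: cut_capacity_def)
qed

text \<open>Take a mincut after the removal of \<open>e\<close>. If \<open>e\<close> did not
  contribute to it in \<open>G\<close>, its capacity there would be the same, hence at least
  \<open>fstar\<close>. So \<open>e\<close> contributes, and restoring it adds
  \<open>w e\<close>.\<close>

lemma vital_edge_cut:
  assumes "vital_edge G w s t e"
  obtains C where "st_cut G s t C" and "e \<in> contributing_edges G C" and "c C < fstar + w e"
proof -
  have cuts: "{C. st_cut (remove_edge G e) s t C} = {C. st_cut G s t C}"
    by (simp add: st_cut_def remove_edge_def)
  have "st_mincut_capacity (remove_edge G e) w s t
      \<in> cut_capacity (remove_edge G e) w ` {C. st_cut G s t C}"
    unfolding st_mincut_capacity_def cuts using finite_st_cuts st_cut_source by (intro Min_in) auto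
  then obtain C where C: "st_cut G s t C" "cut_capacity (remove_edge G e) w C < fstar"
    using assms unfolding vital_edge_def by auto
  then have e: "e \<in> contributing_edges G C"
    using mincut_capacity_le cut_capacity_remove_edge_other by fastforce
  with C that show thesis by (simp add: cut_capacity_remove_edge)
qed

lemma vital_mincut_capacity_less:
  assumes "vital_edge G w s t e" and "mincut_for_edge G w s t e C"
  shows "c C < fstar + w e"
proof -
  obtain D where "st_cut G s t D" "e \<in> contributing_edges G D" "c D < fstar + w e"
    using vital_edge_cut[OF assms(1)] .
  moreover from this have "c C \<le> c D" using assms(2) by (simp add: mincut_for_edge_def)
  ultimately show ?thesis by linarith
qed

lemma vital_edge_mincut_ex:
  assumes "vital_edge G w s t e"
  shows "\<exists>C. mincut_for_edge G w s t e C"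
proof -
  let ?S = "{C. st_cut G s t C \<and> e \<in> contributing_edges G C}"
  have "finite ?S" using finite_st_cuts by (rule rev_finite_subset) blast
  moreover have "?S \<noteq> {}" using vital_edge_cut[OF assms] by blast
  ultimately have "arg_min_on c ?S \<in> ?S" and "\<And>C. C \<in> ?S \<Longrightarrow> c (arg_min_on c ?S) \<le> c C"
    using arg_min_if_finite[of ?S c] by (auto simp: not_less)
  then show ?thesis
    unfolding mincut_for_edge_def by blast
qed

lemma vital_edge_not_entering:
  assumes vital: "vital_edge G w s t e" "vital_edge G w s t e'"
    and C: "mincut_for_edge G w s t e C" and D: "mincut_for_edge G w s t e' D"
  shows "\<not> (fst e' \<notin> C \<and> snd e' \<in> C)"
proof
  assume enter: "fst e' \<notin> C \<and> snd e' \<in> C"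
  have cuts: "st_cut G s t C" "st_cut G s t D"
    and e: "e \<in> parcs G" "fst e \<in> C" "snd e \<notin> C"
    and e': "e' \<in> parcs G" "fst e' \<in> D" "snd e' \<notin> D"
    using C D by (auto simp: mincut_for_edge_def mem_contributing_edges)
  have C_min: "c C \<le> c X" if "st_cut G s t X" "fst e \<in> X" "snd e \<notin> X" for X
    using C that e(1) by (auto simp: mincut_for_edge_def mem_contributing_edges)
  note Int = st_cut_Int[OF cuts] and Un = st_cut_Un[OF cuts]
  note C_less = vital_mincut_capacity_less[OF vital(1) C]
    and D_less = vital_mincut_capacity_less[OF vital(2) D]
  \<comment> \<open>\<open>e'\<close> leaves \<open>D\<close> and enters \<open>C\<close>, so it
    runs from \<open>D - C\<close> to \<open>C - D\<close>.\<close>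
  have single: "c (C \<inter> D) + c (C \<union> D) + w e' \<le> c C + c D"
    using cut_capacity_submodular[of "{e'}" C D] enter e' by auto
  consider "fst e \<in> D" | "fst e \<notin> D" "snd e \<notin> D" | "fst e \<notin> D" "snd e \<in> D" by blast
  then show False
  proof cases
    case 1
    \<comment> \<open>\<open>e\<close> contributes to the intersection. By minimality
      \<open>c C\<close> cancels in \<open>single\<close>, and \<open>D_less\<close> pushes the
      union below \<open>fstar\<close>. The next case exchanges intersection and union.\<close>
    then have "c C \<le> c (C \<inter> D)" using e by (intro C_min Int) auto
    with single D_less mincut_capacity_le[OF Un] show False by linarith
  next
    case 2
    then have "c C \<le> c (C \<union> D)" using e by (intro C_min Un) auto
    with single D_less mincut_capacity_le[OF Int] show False by linarith
  next
    case 3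
    \<comment> \<open>Here \<open>e\<close> runs from \<open>C - D\<close> to \<open>D - C\<close>,
      opposite to \<open>e'\<close>. The two weights outweigh the excess of \<open>c C\<close> and
      \<open>c D\<close> over \<open>fstar\<close>, so intersection and union total less than
      \<open>2 * fstar\<close>.\<close>
    have "e \<noteq> e'" using e enter by blast
    then have "c (C \<inter> D) + c (C \<union> D) + (w e + w e') \<le> c C + c D"
      using cut_capacity_submodular[of "{e, e'}" C D] enter e e' 3 by auto
    with C_less D_less mincut_capacity_le[OF Int] mincut_capacity_le[OF Un]
    show False by linarith
  qed
qed

text \<open>Counting against traces instead of vertices gives an invariant: an added cut raises the
  left side by at most one and the right side by at least one.\<close>

lemma mincut_family:
  assumes "finite F" and "\<And>e. e \<in> F \<Longrightarrow> vital_edge G w s t e"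
    and "\<And>e. e \<in> F \<Longrightarrow> mincut_for_edge G w s t e (M e)"
  shows "\<exists>\<C> \<subseteq> M ` F. card \<C> < card ((\<lambda>v. {C \<in> \<C>. v \<in> C}) ` pverts G) \<and>
    (\<forall>e\<in>F. \<exists>C\<in>\<C>. mincut_for_edge G w s t e C)"
  using assms
proof (induction F rule: finite_ranking_induct[where f = "\<lambda>e. c (M e)"])
  case empty
  \<comment> \<open>No cuts and a single class: \<open>0 < 1\<close>.\<close>
  have "(\<lambda>v. {C \<in> {}. v \<in> C}) ` pverts G = {{}}" using s_in_verts by auto
  then show ?case by simp
next
  case (insert e F)
  then obtain \<C> where sub: "\<C> \<subseteq> M ` F"
    and less: "card \<C> < card ((\<lambda>v. {C \<in> \<C>. v \<in> C}) ` pverts G)"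
    and cover: "\<forall>e\<in>F. \<exists>C\<in>\<C>. mincut_for_edge G w s t e C"
    by auto
  have e: "vital_edge G w s t e" "mincut_for_edge G w s t e (M e)"
    using insert.prems by auto
  then have contr: "e \<in> parcs G" "fst e \<in> M e" "snd e \<notin> M e"
    by (auto simp: mincut_for_edge_def mem_contributing_edges)
  show ?case
  proof (cases "\<exists>C\<in>\<C>. e \<in> contributing_edges G C")
    case True
    then obtain e' where e': "e' \<in> F" "M e' \<in> \<C>" "e \<in> contributing_edges G (M e')"
      using sub by blast
    then have "mincut_for_edge G w s t e' (M e')" and "c (M e') \<le> c (M e)"
      using insert by auto
    \<comment> \<open>\<open>M e'\<close> is no larger than \<open>M e\<close>, which is cheapest
      among the cuts to which \<open>e\<close> contributes.\<close>
    with e(2) e'(3) have "mincut_for_edge G w s t e (M e')"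
      unfolding mincut_for_edge_def by (meson order_trans)
    with e' sub less cover show ?thesis by blast
  next
    case False
    have "fst e \<in> C \<longleftrightarrow> snd e \<in> C" if C: "C \<in> \<C>" for C
    proof -
      obtain e' where e': "e' \<in> F" "C = M e'" using C sub by blast
      \<comment> \<open>\<open>C\<close> is the mincut chosen for the earlier vital edge
        \<open>e'\<close>, so the vital edge \<open>e\<close> cannot enter it.\<close>
      have "\<not> (fst e \<notin> C \<and> snd e \<in> C)"
        using vital_edge_not_entering[of e' e C "M e"] insert.prems e' by auto
      with False C contr(1) show ?thesis by (auto simp: mem_contributing_edges)
    qed
    moreover have "fst e \<in> pverts G" "snd e \<in> pverts G"
      using contr(1) arc_fst_in_verts arc_snd_in_verts by auto
    ultimately have "card ((\<lambda>v. {C \<in> \<C>. v \<in> C}) ` pverts G)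
        < card ((\<lambda>v. {C \<in> insert (M e) \<C>. v \<in> C}) ` pverts G)"
      using contr by (intro card_traces_insert[of _ "fst e" "snd e"]) auto
    moreover have "card (insert (M e) \<C>) \<le> Suc (card \<C>)"
      by (rule card_insert_le_m1) simp_all
    ultimately have "card (insert (M e) \<C>)
        < card ((\<lambda>v. {C \<in> insert (M e) \<C>. v \<in> C}) ` pverts G)"
      using less by linarith
    moreover have "insert (M e) \<C> \<subseteq> M ` insert e F" using sub by blast
    moreover have "\<forall>e'\<in>insert e F. \<exists>C\<in>insert (M e) \<C>. mincut_for_edge G w s t e' C"
      using e(2) cover by auto
    ultimately show ?thesis by (intro exI[of _ "insert (M e) \<C>"] conjI)
  qed
qed

end

theorem theorem1:
  fixes G :: "'a pair_pre_digraph" and w :: "'a \<times> 'a \<Rightarrow> real" and s t :: 'a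
  assumes "pair_fin_digraph G"
    and "\<And>e. e \<in> parcs G \<Longrightarrow> 0 < w e"
    and "s \<in> pverts G" and "t \<in> pverts G" and "t \<noteq> s"
  shows "\<exists>\<C>. finite \<C> \<and> card \<C> \<le> card (pverts G) - 1 \<and>
           (\<forall>C \<in> \<C>. st_cut G s t C) \<and>
           (\<forall>e. vital_edge G w s t e \<longrightarrow> (\<exists>C \<in> \<C>. mincut_for_edge G w s t e C))"
proof -
  interpret st_network G w s t
    using assms by (simp add: st_network_def st_network_axioms_def)
  let ?F = "{e. vital_edge G w s t e}"
  have fin: "finite ?F"
    by (rule finite_subset[OF _ pair_finite_arcs]) (auto simp: vital_edge_def)
  obtain M where M: "\<And>e. vital_edge G w s t e \<Longrightarrow> mincut_for_edge G w s t e (M e)"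
    using vital_edge_mincut_ex by metis
  obtain \<C> where \<C>: "\<C> \<subseteq> M ` ?F" "card \<C> < card ((\<lambda>v. {C \<in> \<C>. v \<in> C}) ` pverts G)"
    "\<forall>e\<in>?F. \<exists>C\<in>\<C>. mincut_for_edge G w s t e C"
    using mincut_family[OF fin, of M] M by auto
  have "card \<C> < card (pverts G)"
    using \<C>(2) card_image_le[OF pair_finite_verts] by (rule less_le_trans)
  moreover have "finite \<C>" using \<C>(1) fin by (meson finite_imageI finite_subset)
  moreover have "\<forall>C\<in>\<C>. st_cut G s t C" using \<C>(1) M unfolding mincut_for_edge_def by blast
  ultimately show ?thesis using \<C>(3) by (intro exI[of _ \<C>]) auto
qed

end
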